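(* Fix $\kappa_{max}>0$ and consider trajectories $\gamma:[0,T]\to\mathbb{R}^2$ with continuous second derivatives whose curvature is bounded by $\kappa_{max}$. Then: (i) for $r>0$, the square count $C_{S_r}$ is an unstable count; (ii) if $r<\frac{1}{\kappa_{max}}$, the disk count $C_{B_r}$ is stable; (iii) if $r_1<r_2<\frac{1}{\kappa_{max}}$, the robust local square count $C_{S_{r_1},S_{r_2}}$ is stable (to perturbations of a trajectory).
   Context: For $r>0$ and $x=(x_1,x_2)\in\mathbb{R}^2$ let $B_r(x)$ be the closed Euclidean disk of radius $r$ about $x$ and $S_r(x)=\{y:\max(|y_1-x_1|,|y_2-x_2|)\le r\}$ the closed square. For a trajectory $\gamma:[0,T]\to\mathbb{R}^2$ and a set $K\subset\mathbb{R}^2$, let $A_K$ be the set of intervals $[a,b]\subset[0,T]$ with $\gamma([a,b])\subset K$ that are maximal with this property (no strictly larger subinterval of $[0,T]$ containing $[a,b]$ has trace in $K$). Define $C_{B_r}(x)=|A_{B_r(x)}|$ and $C_{S_r}(x)=|A_{S_r(x)}|$. For $r_1<r_2$, intervals $[a_1,b_1],[a_2,b_2]\in A_{S_{r_1}(x)}$ are equivalent if some $[a,b]\in A_{S_{r_2}(x)}$ satisfies $[a_1,b_1]\cup[a_2,b_2]\subset[a,b]$; $C_{S_{r_1},S_{r_2}}(x)$ is the number of equivalence classes of $A_{S_{r_1}(x)}$ under this relation. An $\epsilon$-perturbation of a trajectory $\gamma$ with curvature bounded by $\kappa_{max}$ is a trajectory $\hat\gamma$ on the same time domain, with the same curvature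 bound, such that $\|\hat\gamma(t)-\gamma(t)\|_2\le\epsilon$ for all $t$; it is small if $\epsilon<\frac{1}{\kappa_{max}}$. A count function $C$ (assigning to each trajectory a function $\mathbb{R}^2\to\mathbb{N}$) is stable if for every trajectory $\gamma$ with curvature bounded by $\kappa_{max}$ the change in its value due to any small $\epsilon$-perturbation is bounded everywhere, i.e. there is a bound $M(\gamma)$ (which may depend on $\gamma$) such that $|C[\hat\gamma](x)-C[\gamma](x)|\le M(\gamma)$ for all small $\epsilon$-perturbations $\hat\gamma$ of $\gamma$ and all $x\in\mathbb{R}^2$; otherwise it is unstable. *)

theory Defs
  imports "HOL-Analysis.Analysis" "HOL-Library.Extended_Nat"
begin

type_synonym pt = "real \<times> real"

text \<open>Closed Euclidean disk (cball, product norm on real*real is Euclidean) and closed square.\<close>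
definition disk :: "real \<Rightarrow> pt \<Rightarrow> pt set" where
  "disk r x = cball x r"

definition square :: "real \<Rightarrow> pt \<Rightarrow> pt set" where
  "square r x = {y. max \<bar>fst y - fst x\<bar> \<bar>snd y - snd x\<bar> \<le> r}"

definition curv :: "pt \<Rightarrow> pt \<Rightarrow> real" where
  "curv d dd = \<bar>fst d * snd dd - snd d * fst dd\<bar> / (norm d) ^ 3"

definition trajectory :: "real \<Rightarrow> real \<Rightarrow> (real \<Rightarrow> pt) \<Rightarrow> bool" where
  "trajectory kmax T \<gamma> \<longleftrightarrow>
     (\<exists>\<gamma>1 \<gamma>2. continuous_on {0..T} \<gamma>2 \<and>
       (\<forall>t\<in>{0..T}. (\<gamma> has_vector_derivative \<gamma>1 t) (at t within {0..T}) \<and>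
                    (\<gamma>1 has_vector_derivative \<gamma>2 t) (at t within {0..T}) \<and>
                    \<gamma>1 t \<noteq> 0 \<and> curv (\<gamma>1 t) (\<gamma>2 t) \<le> kmax))"

definition maxints :: "real \<Rightarrow> (real \<Rightarrow> pt) \<Rightarrow> pt set \<Rightarrow> (real \<times> real) set" where
  "maxints T \<gamma> K = {(a, b). 0 \<le> a \<and> a \<le> b \<and> b \<le> T \<and> \<gamma> ` {a..b} \<subseteq> K \<and>
      (\<forall>a' b'. 0 \<le> a' \<and> a' \<le> a \<and> b \<le> b' \<and> b' \<le> T \<and> \<gamma> ` {a'..b'} \<subseteq> K
               \<longrightarrow> a' = a \<and> b' = b)}"

definition ecount :: "'a set \<Rightarrow> enat" where
  "ecount A = (if finite A then enat (card A) else \<infinity>)"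

definition disk_count :: "real \<Rightarrow> real \<Rightarrow> (real \<Rightarrow> pt) \<Rightarrow> pt \<Rightarrow> enat" where
  "disk_count r T \<gamma> x = ecount (maxints T \<gamma> (disk r x))"

definition square_count :: "real \<Rightarrow> real \<Rightarrow> (real \<Rightarrow> pt) \<Rightarrow> pt \<Rightarrow> enat" where
  "square_count r T \<gamma> x = ecount (maxints T \<gamma> (square r x))"

definition robust_rel :: "real \<Rightarrow> real \<Rightarrow> real \<Rightarrow> (real \<Rightarrow> pt) \<Rightarrow> pt \<Rightarrow> ((real \<times> real) \<times> (real \<times> real)) set" where
  "robust_rel r1 r2 T \<gamma> x = {((a1, b1), (a2, b2)).
      (a1, b1) \<in> maxints T \<gamma> (square r1 x) \<and> (a2, b2) \<in> maxints T \<gamma> (square r1 x) \<and>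
      (\<exists>(a, b) \<in> maxints T \<gamma> (square r2 x). {a1..b1} \<union> {a2..b2} \<subseteq> {a..b})}"

definition robust_count :: "real \<Rightarrow> real \<Rightarrow> real \<Rightarrow> (real \<Rightarrow> pt) \<Rightarrow> pt \<Rightarrow> enat" where
  "robust_count r1 r2 T \<gamma> x =
     ecount (maxints T \<gamma> (square r1 x) // robust_rel r1 r2 T \<gamma> x)"

definition small_perturbation :: "real \<Rightarrow> real \<Rightarrow> (real \<Rightarrow> pt) \<Rightarrow> (real \<Rightarrow> pt) \<Rightarrow> bool" where
  "small_perturbation kmax T \<gamma> \<gamma>' \<longleftrightarrow>
     trajectory kmax T \<gamma>' \<and>
     (\<exists>eps. eps < 1 / kmax \<and> (\<forall>t\<in>{0..T}. dist (\<gamma>' t) (\<gamma> t) \<le> eps))"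

definition stable :: "real \<Rightarrow> (real \<Rightarrow> (real \<Rightarrow> pt) \<Rightarrow> pt \<Rightarrow> enat) \<Rightarrow> bool" where
  "stable kmax C \<longleftrightarrow>
     (\<forall>T \<gamma>. T > 0 \<and> trajectory kmax T \<gamma> \<longrightarrow>
        (\<exists>M::nat. \<forall>\<gamma>' x. small_perturbation kmax T \<gamma> \<gamma>' \<longrightarrow>
            C T \<gamma>' x \<le> C T \<gamma> x + enat M \<and> C T \<gamma> x \<le> C T \<gamma>' x + enat M))"

end

theory Submission
  imports Defs
begin

text \<open>
  Parts (ii) and (iii) rest on one fact: all small perturbations \<open>\<gamma>'\<close> of \<open>\<gamma>\<close> have length at most some
  \<open>L(\<gamma>)\<close>. Let \<open>f = \<gamma>' - \<gamma>\<close>, so \<open>|f| < 1/k\<close>, and let \<open>\<gamma>'\<close> have speed \<open>\<sigma>\<close>, tangent angle \<open>\<theta>\<close>, unit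
  tangent \<open>t\<close>, unit normal \<open>n\<close> and turning rate \<open>\<omega> = d\<theta>\<close>, so \<open>|\<omega>| \<le> k \<sigma>\<close>. On a time interval where the
  velocity of \<open>\<gamma>\<close> has positive component along a fixed unit vector \<open>v\<close>, the functions
  \<open>f \<bullet> v \<plusminus> sin(\<theta> - arg v)/k\<close> decrease while \<open>t \<bullet> v \<le> 0\<close>; since \<open>|f \<bullet> v| < 1/k\<close>, the tangent cannot
  traverse the half circle opposite to \<open>v\<close>, and \<open>\<theta>\<close> varies by at most \<open>H = 3 pi\<close>. With \<open>\<psi>\<close> the
  angle turned so far, the bounded function
  \<open>(f \<bullet> t) (1 + (H\<^sup>2 - \<psi>\<^sup>2)/2) - (f \<bullet> n) \<psi>\<close> has derivative at least \<open>\<sigma>\<close> minus a constant, which bounds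
  the length. Finitely many such time intervals cover the domain.

  Distinct maximal intervals in a disk of radius \<open>r < 1/k\<close> are separated by a point at distance at
  least \<open>1/k\<close> from its centre, and distinct robust classes by a point outside the larger square, so
  each costs a fixed amount of length.

  For (i), a segment running along the side of a square is perturbed by a sine wave of high
  frequency and tiny amplitude.
\<close>

section \<open>Derivatives and crossings on an interval\<close>

text \<open>The gauge integral exists for every derivative, so integrability is asked of
  \<open>g\<close> alone. This fits turning rates, which are given below only as pointwise
  derivatives of the tangent angle.\<close>

lemma diff_le_integral_of_deriv_ge:
  fixes f f' g :: "real \<Rightarrow> real"
  assumes "a \<le> b" "\<And>t. t \<in> {a..b} \<Longrightarrow> (f has_real_derivative f' t) (at t within {a..b})"
    and "g integrable_on {a..b}" "\<And>t. t \<in> {a..b} \<Longrightarrow> g t \<le> f' t"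
  shows "integral {a..b} g \<le> f b - f a"
proof -
  have "(f' has_integral (f b - f a)) {a..b}"
    using assms(1,2) by (intro fundamental_theorem_of_calculus)
      (auto simp: has_real_derivative_iff_has_vector_derivative)
  with assms(3,4) show ?thesis
    using has_integral_le integrable_integral by blast
qed

lemma le_of_deriv_nonneg_within:
  fixes f f' :: "real \<Rightarrow> real"
  assumes "a \<le> b" "\<And>t. t \<in> {a..b} \<Longrightarrow> (f has_real_derivative f' t) (at t within {a..b})"
    and "\<And>t. t \<in> {a..b} \<Longrightarrow> 0 \<le> f' t"
  shows "f a \<le> f b"
proof -
  have "integral {a..b} (\<lambda>_. 0) \<le> f b - f a"
    using assms by (intro diff_le_integral_of_deriv_ge[where f' = f']) (auto intro: integrable_0)
  then show ?thesis by simp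
qed

lemma eq_of_deriv_zero_within:
  fixes f :: "real \<Rightarrow> real"
  assumes "a \<le> b" "\<And>t. t \<in> {a..b} \<Longrightarrow> (f has_real_derivative 0) (at t within {a..b})"
  shows "f a = f b"
proof (rule antisym)
  show "f a \<le> f b" using le_of_deriv_nonneg_within[of a b f "\<lambda>_. 0"] assms by simp
  have "((\<lambda>t. - f t) has_real_derivative 0) (at t within {a..b})" if "t \<in> {a..b}" for t
    using DERIV_minus[OF assms(2)[OF that]] by simp
  then show "f b \<le> f a"
    using le_of_deriv_nonneg_within[of a b "\<lambda>t. - f t" "\<lambda>_. 0"] assms(1) by simp
qed

lemma compact_level_set:
  fixes \<phi> :: "real \<Rightarrow> real"
  assumes "continuous_on {a..b} \<phi>"
  shows "compact {t\<in>{a..b}. \<phi> t = y}"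
proof -
  have "closed {t\<in>{a..b}. \<phi> t = y}"
    using assms by (intro continuous_closed_preimage_constant) auto
  from compact_Int_closed[OF compact_Icc this, of a b] show ?thesis
    by (simp add: Int_absorb1 subset_eq)
qed

text \<open>Take \<open>a'\<close> as the last time at the starting level and \<open>b'\<close> as
  the first later time at the final level. Leaving the band in between would, by the intermediate
  value theorem, produce a later \<open>a'\<close> or an earlier \<open>b'\<close>.\<close>

lemma crossing_subinterval_up:
  fixes \<phi> :: "real \<Rightarrow> real"
  assumes "a \<le> b" "continuous_on {a..b} \<phi>" "\<phi> a < \<phi> b"
  obtains a' b' where "a \<le> a'" "a' \<le> b'" "b' \<le> b" "\<phi> a' = \<phi> a" "\<phi> b' = \<phi> b"
    "\<And>t. t \<in> {a'..b'} \<Longrightarrow> \<phi> t \<in> {\<phi> a..\<phi> b}"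
proof -
  let ?A = "{t\<in>{a..b}. \<phi> t = \<phi> a}"
  have "compact ?A"
    by (rule compact_level_set[OF assms(2)])
  moreover have "a \<in> ?A" using assms by auto
  ultimately obtain a' where a': "a' \<in> ?A" "\<And>t. t \<in> ?A \<Longrightarrow> t \<le> a'"
    using compact_attains_sup[of ?A] by blast
  have cont: "continuous_on {u..v} \<phi>" if "a \<le> u" "v \<le> b" for u v
    using assms(2) by (rule continuous_on_subset) (use that in auto)
  let ?B = "{t\<in>{a'..b}. \<phi> t = \<phi> b}"
  have "compact ?B"
    using cont[of a' b] a'(1) by (intro compact_level_set) simp
  moreover have "b \<in> ?B" using a' by auto
  ultimately obtain b' where b': "b' \<in> ?B" "\<And>t. t \<in> ?B \<Longrightarrow> b' \<le> t"
    using compact_attains_inf[of ?B] by blast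
  have "\<phi> t \<in> {\<phi> a..\<phi> b}" if t: "t \<in> {a'..b'}" for t
  proof (rule ccontr)
    assume "\<phi> t \<notin> {\<phi> a..\<phi> b}"
    then consider "\<phi> t < \<phi> a" | "\<phi> b < \<phi> t" by force
    then show False
    proof cases
      case 1
      obtain u where "t \<le> u" "u \<le> b'" "\<phi> u = \<phi> a"
        using IVT'[of \<phi> t "\<phi> a" b'] 1 t a'(1) b'(1) assms(3) cont[of t b'] by auto
      with a'(2)[of u] a'(1) b'(1) t have "u = a'" "t = a'" by auto
      with 1 a'(1) show False by auto
    next
      case 2
      obtain u where "a' \<le> u" "u \<le> t" "\<phi> u = \<phi> b"
        using IVT'[of \<phi> a' "\<phi> b" t] 2 t a'(1) b'(1) assms(3) cont[of a' t] by auto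
      with b'(2)[of u] a'(1) b'(1) t have "u = b'" "t = b'" by auto
      with 2 b'(1) show False by auto
    qed
  qed
  with that[of a' b'] a'(1) b'(1) show ?thesis by auto
qed

lemma crossing_subinterval_down:
  fixes \<phi> :: "real \<Rightarrow> real"
  assumes "a \<le> b" "continuous_on {a..b} \<phi>" "\<phi> b < \<phi> a"
  obtains a' b' where "a \<le> a'" "a' \<le> b'" "b' \<le> b" "\<phi> a' = \<phi> a" "\<phi> b' = \<phi> b"
    "\<And>t. t \<in> {a'..b'} \<Longrightarrow> \<phi> t \<in> {\<phi> b..\<phi> a}"
proof -
  have "continuous_on {a..b} (\<lambda>t. - \<phi> t)" using assms(2) by (intro continuous_intros)
  moreover have "- \<phi> a < - \<phi> b" using assms(3) by simp
  ultimately obtain a' b' where "a \<le> a'" "a' \<le> b'" "b' \<le> b" "- \<phi> a' = - \<phi> a"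
    "- \<phi> b' = - \<phi> b" "\<And>t. t \<in> {a'..b'} \<Longrightarrow> - \<phi> t \<in> {- \<phi> a..- \<phi> b}"
    using crossing_subinterval_up[OF assms(1), of "\<lambda>t. - \<phi> t"] by metis
  with that[of a' b'] show thesis by simp
qed

section \<open>Bounded turning\<close>

text \<open>The function \<open>c * sin (\<phi> t) / k - f t\<close> is nondecreasing while the
  cosine is nonpositive. Its sine term drops by \<open>2 / k\<close> from \<open>a\<close> to
  \<open>b\<close>, and \<open>f\<close> varies by strictly less than \<open>2 / k\<close>, so it
  would have to decrease. The sign \<open>c\<close> covers both senses of traversal;
  \<open>p\<close> stands for the velocity component of the unperturbed curve along the fixed
  direction.\<close>

lemma no_half_turn:
  fixes f \<phi> \<sigma> \<omega> p :: "real \<Rightarrow> real"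
  assumes k: "0 < k" and ab: "a \<le> b"
    and f: "\<And>t. t \<in> {a..b} \<Longrightarrow> (f has_real_derivative \<sigma> t * cos (\<phi> t) - p t) (at t within {a..b})"
    and \<phi>: "\<And>t. t \<in> {a..b} \<Longrightarrow> (\<phi> has_real_derivative \<omega> t) (at t within {a..b})"
    and \<omega>: "\<And>t. t \<in> {a..b} \<Longrightarrow> \<bar>\<omega> t\<bar> \<le> k * \<sigma> t"
    and p: "\<And>t. t \<in> {a..b} \<Longrightarrow> 0 \<le> p t"
    and small: "\<And>t. t \<in> {a..b} \<Longrightarrow> \<bar>f t\<bar> < 1 / k"
    and cos: "\<And>t. t \<in> {a..b} \<Longrightarrow> cos (\<phi> t) \<le> 0"
    and c: "\<bar>c\<bar> = 1" "sin (\<phi> a) = c" "sin (\<phi> b) = - c"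
  shows False
proof -
  let ?F = "\<lambda>t. c * sin (\<phi> t) / k - f t"
  have "?F a \<le> ?F b"
  proof (rule le_of_deriv_nonneg_within[OF ab])
    fix t assume t: "t \<in> {a..b}"
    show "(?F has_real_derivative (c * \<omega> t / k - \<sigma> t) * cos (\<phi> t) + p t) (at t within {a..b})"
      using k by (auto intro!: derivative_eq_intros f[OF t] \<phi>[OF t] simp: field_simps)
    have "c * \<omega> t \<le> k * \<sigma> t" using c(1) \<omega>[OF t] by (cases "c = 1") (auto simp: abs_if split: if_splits)
    then have "c * \<omega> t / k - \<sigma> t \<le> 0" using k by (simp add: field_simps)
    then show "0 \<le> (c * \<omega> t / k - \<sigma> t) * cos (\<phi> t) + p t"
      using cos[OF t] p[OF t] mult_nonpos_nonpos by fastforce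
  qed
  moreover have "c * c = 1" using c(1) by (metis abs_mult_self_eq mult_1)
  ultimately show False using small[of a] small[of b] ab by (simp add: c)
qed

text \<open>Every range of angles longer than \<open>3 * pi\<close> contains a complete half circle
  on which the cosine is nonpositive, and traversing that one is impossible. The times
  \<open>s\<close> and \<open>t\<close> may come in either order, so exchanging them gives a
  two-sided bound.\<close>

lemma turning_bound:
  fixes f \<phi> \<sigma> \<omega> p :: "real \<Rightarrow> real"
  assumes k: "0 < k"
    and f: "\<And>t. t \<in> {a..b} \<Longrightarrow> (f has_real_derivative \<sigma> t * cos (\<phi> t) - p t) (at t within {a..b})"
    and \<phi>: "\<And>t. t \<in> {a..b} \<Longrightarrow> (\<phi> has_real_derivative \<omega> t) (at t within {a..b})"
    and \<omega>: "\<And>t. t \<in> {a..b} \<Longrightarrow> \<bar>\<omega> t\<bar> \<le> k * \<sigma> t"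
    and p: "\<And>t. t \<in> {a..b} \<Longrightarrow> 0 \<le> p t"
    and small: "\<And>t. t \<in> {a..b} \<Longrightarrow> \<bar>f t\<bar> < 1 / k"
    and st: "s \<in> {a..b}" "t \<in> {a..b}"
  shows "\<phi> t \<le> \<phi> s + 3 * pi"
proof (rule ccontr)
  assume *: "\<not> \<phi> t \<le> \<phi> s + 3 * pi"
  \<comment> \<open>\<open>A\<close> is the least number congruent to \<open>pi/2\<close> modulo
    \<open>2 * pi\<close> that is at least \<open>\<phi> s\<close>. It exceeds
    \<open>\<phi> s\<close> by less than \<open>2 * pi\<close>, so \<open>A + pi\<close> is still
    below \<open>\<phi> t\<close>.\<close>
  define n where "n = \<lceil>(\<phi> s - pi/2) / (2 * pi)\<rceil>"
  define A where "A = pi/2 + 2 * pi * of_int n"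
  have "(\<phi> s - pi/2) / (2 * pi) \<le> of_int n" "of_int n < (\<phi> s - pi/2) / (2 * pi) + 1"
    unfolding n_def by linarith+
  then have A: "\<phi> s \<le> A" "A < \<phi> s + 2 * pi" unfolding A_def by (simp_all add: field_simps)
  have cos: "cos (A + z) = - sin z" and sin: "sin (A + z) = cos z" for z
    by (simp_all add: A_def cos_add sin_add)
  have cont: "continuous_on {a..b} \<phi>"
    using \<phi> DERIV_continuous continuous_on_eq_continuous_within by blast
  have "connected (\<phi> ` {a..b})" using cont by (intro connected_continuous_image) auto
  then have "{\<phi> s..\<phi> t} \<subseteq> \<phi> ` {a..b}" using st by (intro connected_contains_Icc) auto
  moreover have "A \<in> {\<phi> s..\<phi> t}" "A + pi \<in> {\<phi> s..\<phi> t}" using A * pi_gt_zero by auto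
  ultimately obtain u v where uv: "u \<in> {a..b}" "v \<in> {a..b}" "\<phi> u = A" "\<phi> v = A + pi"
    by (metis (no_types, lifting) imageE subsetD)
  have neg: "cos y \<le> 0" if "y \<in> {A..A + pi}" for y
    using cos[of "y - A"] sin_ge_zero[of "y - A"] that by simp
  \<comment> \<open>Used with \<open>c = 1\<close> when the half circle is traversed upwards from
    \<open>A\<close> to \<open>A + pi\<close>, and with \<open>c = -1\<close> when it is traversed
    downwards.\<close>
  have main: False if "a \<le> a'" "a' \<le> b'" "b' \<le> b" "\<bar>c\<bar> = 1" "sin (\<phi> a') = c" "sin (\<phi> b') = - c"
      "\<And>t. t \<in> {a'..b'} \<Longrightarrow> \<phi> t \<in> {A..A + pi}" for a' b' c
  proof -
    have sub: "{a'..b'} \<subseteq> {a..b}" using that by auto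
    show False
      by (rule no_half_turn[OF k that(2) _ _ _ _ _ _ that(4-6), of f \<sigma> p \<omega>])
        (use sub in \<open>auto intro!: DERIV_subset[OF f sub] DERIV_subset[OF \<phi> sub] neg that(7) intro: \<omega> p small\<close>)
  qed
  have sA: "sin A = 1" and sB: "sin (A + pi) = -1" using sin[of 0] sin[of pi] by simp_all
  have cont': "continuous_on {u'..v'} \<phi>" if "a \<le> u'" "v' \<le> b" for u' v'
    using cont by (rule continuous_on_subset) (use that in auto)
  show False
  proof (cases "u \<le> v")
    case True
    have "continuous_on {u..v} \<phi>" "\<phi> u < \<phi> v" using uv cont' by simp_all
    from crossing_subinterval_up[OF True this] obtain a' b' where
      *: "u \<le> a'" "a' \<le> b'" "b' \<le> v" "\<phi> a' = \<phi> u" "\<phi> b' = \<phi> v"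
        "\<And>t. t \<in> {a'..b'} \<Longrightarrow> \<phi> t \<in> {\<phi> u..\<phi> v}" by metis
    show False
      using main[of a' b' 1] * uv sA sB by simp
  next
    case False
    then have vu: "v \<le> u" by simp
    have "continuous_on {v..u} \<phi>" "\<phi> u < \<phi> v" using uv cont' by simp_all
    from crossing_subinterval_down[OF vu this] obtain a' b' where
      *: "v \<le> a'" "a' \<le> b'" "b' \<le> u" "\<phi> a' = \<phi> v" "\<phi> b' = \<phi> u"
        "\<And>t. t \<in> {a'..b'} \<Longrightarrow> \<phi> t \<in> {\<phi> u..\<phi> v}" by metis
    show False
      using main[of a' b' "-1"] * uv sA sB by simp
  qed
qed

section \<open>Polar form of a trajectory\<close>

text \<open>Speed, tangent angle and turning rate. The angle is a differentiable real-valued lift,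
  not reduced modulo \<open>2 * pi\<close>, so differences of its values measure total turning; the
  curvature bound becomes a bound on its derivative.\<close>

definition polar_form ::
    "real \<Rightarrow> real \<Rightarrow> (real \<Rightarrow> pt) \<Rightarrow> (real \<Rightarrow> real) \<Rightarrow> (real \<Rightarrow> real) \<Rightarrow> (real \<Rightarrow> real) \<Rightarrow> bool" where
  "polar_form k T \<gamma> \<sigma> \<theta> \<omega> \<longleftrightarrow> continuous_on {0..T} \<sigma> \<and>
     (\<forall>t\<in>{0..T}.
        ((\<lambda>t. fst (\<gamma> t)) has_real_derivative \<sigma> t * cos (\<theta> t)) (at t within {0..T}) \<and>
        ((\<lambda>t. snd (\<gamma> t)) has_real_derivative \<sigma> t * sin (\<theta> t)) (at t within {0..T}) \<and>
        (\<theta> has_real_derivative \<omega> t) (at t within {0..T}) \<and>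
        0 < \<sigma> t \<and> \<bar>\<omega> t\<bar> \<le> k * \<sigma> t)"

text \<open>The angle is obtained by integrating the turning rate from an initial angle. The unit
  tangent \<open>(c, s)\<close> and \<open>(cos \<theta>, sin \<theta>)\<close> then solve the same
  linear rotation equation with the same initial value, hence agree.\<close>

lemma exists_polar_form:
  assumes "trajectory k T \<gamma>" "0 < T"
  obtains \<sigma> \<theta> \<omega> where "polar_form k T \<gamma> \<sigma> \<theta> \<omega>"
proof -
  from assms obtain \<gamma>1 \<gamma>2 where cont2: "continuous_on {0..T} \<gamma>2"
    and d1: "\<And>t. t \<in> {0..T} \<Longrightarrow> (\<gamma> has_vector_derivative \<gamma>1 t) (at t within {0..T})"
    and d2: "\<And>t. t \<in> {0..T} \<Longrightarrow> (\<gamma>1 has_vector_derivative \<gamma>2 t) (at t within {0..T})"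
    and nz: "\<And>t. t \<in> {0..T} \<Longrightarrow> \<gamma>1 t \<noteq> 0"
    and curv: "\<And>t. t \<in> {0..T} \<Longrightarrow> curv (\<gamma>1 t) (\<gamma>2 t) \<le> k"
    unfolding trajectory_def by blast
  define x where "x t = fst (\<gamma>1 t)" for t
  define y where "y t = snd (\<gamma>1 t)" for t
  define x' where "x' t = fst (\<gamma>2 t)" for t
  define y' where "y' t = snd (\<gamma>2 t)" for t
  define \<sigma> where "\<sigma> t = sqrt ((x t)\<^sup>2 + (y t)\<^sup>2)" for t
  define \<omega> where "\<omega> t = (x t * y' t - y t * x' t) / (\<sigma> t)\<^sup>2" for t
  define c where "c t = x t / \<sigma> t" for t
  define s where "s t = y t / \<sigma> t" for t
  have sig: "0 < \<sigma> t" and sig2: "(\<sigma> t)\<^sup>2 = (x t)\<^sup>2 + (y t)\<^sup>2" if "t \<in> {0..T}" for t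
    using nz[OF that] by (auto simp: \<sigma>_def x_def y_def sum_power2_gt_zero_iff prod_eq_iff)
  have dx: "(x has_real_derivative x' t) (at t within {0..T})"
    and dy: "(y has_real_derivative y' t) (at t within {0..T})" if "t \<in> {0..T}" for t
    using bounded_linear.has_vector_derivative[OF bounded_linear_fst d2[OF that]]
      bounded_linear.has_vector_derivative[OF bounded_linear_snd d2[OF that]]
    unfolding has_real_derivative_iff_has_vector_derivative x_def y_def x'_def y'_def by simp_all
  have contx: "continuous_on {0..T} x" "continuous_on {0..T} y"
    using dx dy DERIV_continuous continuous_on_eq_continuous_within by blast+
  have contx': "continuous_on {0..T} x'" "continuous_on {0..T} y'"
    unfolding x'_def y'_def by (intro continuous_intros cont2)+
  have cont\<sigma>: "continuous_on {0..T} \<sigma>"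
    unfolding \<sigma>_def by (intro continuous_intros contx)
  have cont\<omega>: "continuous_on {0..T} \<omega>"
    unfolding \<omega>_def using sig by (intro continuous_intros contx contx' cont\<sigma>) force
  have d\<sigma>: "(\<sigma> has_real_derivative (x t * x' t + y t * y' t) / \<sigma> t) (at t within {0..T})"
    if t: "t \<in> {0..T}" for t
  proof -
    have N: "((\<lambda>t. (x t)\<^sup>2 + (y t)\<^sup>2) has_real_derivative 2 * (x t * x' t + y t * y' t)) (at t within {0..T})"
      by (auto intro!: derivative_eq_intros dx[OF t] dy[OF t])
    have "0 < (x t)\<^sup>2 + (y t)\<^sup>2" using sig[OF t] by (simp add: \<sigma>_def)
    from DERIV_chain2[OF DERIV_real_sqrt[OF this] N]
    have "(\<sigma> has_real_derivative inverse (\<sigma> t) / 2 * (2 * (x t * x' t + y t * y' t))) (at t within {0..T})"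
      unfolding \<sigma>_def .
    moreover have "inverse w / 2 * (2 * z) = z / w" for w z :: real by (simp add: field_simps)
    ultimately show ?thesis by metis
  qed
  have dc: "(c has_real_derivative - \<omega> t * s t) (at t within {0..T})" if t: "t \<in> {0..T}" for t
  proof -
    have "(c has_real_derivative (x' t * \<sigma> t - x t * ((x t * x' t + y t * y' t) / \<sigma> t)) / (\<sigma> t * \<sigma> t))
        (at t within {0..T})"
      unfolding c_def using sig[OF t] by (intro DERIV_divide dx[OF t] d\<sigma>[OF t]) simp
    also have "(x' t * \<sigma> t - x t * ((x t * x' t + y t * y' t) / \<sigma> t)) / (\<sigma> t * \<sigma> t)
        = (x' t * (\<sigma> t)\<^sup>2 - x t * (x t * x' t + y t * y' t)) / (\<sigma> t) ^ 3"
      using sig[OF t] by (simp add: field_simps power2_eq_square power3_eq_cube)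
    also have "\<dots> = - \<omega> t * s t"
      using sig[OF t] unfolding sig2[OF t]
      by (simp add: \<omega>_def s_def) (simp add: divide_simps, simp add: algebra_simps power2_eq_square power3_eq_cube)
    finally show ?thesis .
  qed
  have ds: "(s has_real_derivative \<omega> t * c t) (at t within {0..T})" if t: "t \<in> {0..T}" for t
  proof -
    have "(s has_real_derivative (y' t * \<sigma> t - y t * ((x t * x' t + y t * y' t) / \<sigma> t)) / (\<sigma> t * \<sigma> t))
        (at t within {0..T})"
      unfolding s_def using sig[OF t] by (intro DERIV_divide dy[OF t] d\<sigma>[OF t]) simp
    also have "(y' t * \<sigma> t - y t * ((x t * x' t + y t * y' t) / \<sigma> t)) / (\<sigma> t * \<sigma> t)
        = (y' t * (\<sigma> t)\<^sup>2 - y t * (x t * x' t + y t * y' t)) / (\<sigma> t) ^ 3"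
      using sig[OF t] by (simp add: field_simps power2_eq_square power3_eq_cube)
    also have "\<dots> = \<omega> t * c t"
      using sig[OF t] unfolding sig2[OF t]
      by (simp add: \<omega>_def c_def) (simp add: divide_simps, simp add: algebra_simps power2_eq_square power3_eq_cube)
    finally show ?thesis .
  qed
  have unit: "(c t)\<^sup>2 + (s t)\<^sup>2 = 1" if "t \<in> {0..T}" for t
    using sig[OF that]
    by (simp add: c_def s_def power_divide sig2[OF that, symmetric] flip: add_divide_distrib)
  obtain \<theta>0 where \<theta>0: "c 0 = cos \<theta>0" "s 0 = sin \<theta>0"
    using sincos_total_2pi[OF unit[of 0]] assms(2) by auto
  define \<theta> where "\<theta> t = \<theta>0 + integral {0..t} \<omega>" for t
  have d\<theta>: "(\<theta> has_real_derivative \<omega> t) (at t within {0..T})" if "t \<in> {0..T}" for t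
    unfolding \<theta>_def using integral_has_real_derivative[OF cont\<omega> that]
    by (auto intro!: derivative_eq_intros)
  have eq: "c t = cos (\<theta> t) \<and> s t = sin (\<theta> t)" if t: "t \<in> {0..T}" for t
  proof -
    \<comment> \<open>The inner product of the two unit vectors is constant and equals 1 at time 0;
      unit vectors with inner product 1 coincide.\<close>
    let ?h = "\<lambda>t. c t * cos (\<theta> t) + s t * sin (\<theta> t)"
    have "?h 0 = ?h t"
    proof (rule eq_of_deriv_zero_within[where f = ?h])
      fix u assume u: "u \<in> {0..t}"
      then have uT: "u \<in> {0..T}" using t by auto
      have "(?h has_real_derivative 0) (at u within {0..T})"
        by (auto intro!: derivative_eq_intros dc[OF uT] ds[OF uT] d\<theta>[OF uT] simp: algebra_simps)
      then show "(?h has_real_derivative 0) (at u within {0..t})"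
        by (rule DERIV_subset) (use t in auto)
    qed (use t in auto)
    moreover have "?h 0 = 1" by (simp add: \<theta>0 \<theta>_def flip: power2_eq_square)
    ultimately have "(c t - cos (\<theta> t))\<^sup>2 + (s t - sin (\<theta> t))\<^sup>2 = 0"
      using unit[OF t] sin_cos_squared_add[of "\<theta> t"] unfolding power2_diff by linarith
    then show ?thesis by (simp add: sum_power2_eq_zero_iff)
  qed
  have "polar_form k T \<gamma> \<sigma> \<theta> \<omega>"
    unfolding polar_form_def
  proof (intro conjI ballI)
    show "continuous_on {0..T} \<sigma>" by (fact cont\<sigma>)
    fix t assume t: "t \<in> {0..T}"
    show "(\<theta> has_real_derivative \<omega> t) (at t within {0..T})" "0 < \<sigma> t"
      by (fact d\<theta>[OF t], fact sig[OF t])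
    have "x t = \<sigma> t * cos (\<theta> t)" "y t = \<sigma> t * sin (\<theta> t)"
      using eq[OF t] sig[OF t] by (auto simp: c_def s_def field_simps)
    then show "((\<lambda>t. fst (\<gamma> t)) has_real_derivative \<sigma> t * cos (\<theta> t)) (at t within {0..T})"
      "((\<lambda>t. snd (\<gamma> t)) has_real_derivative \<sigma> t * sin (\<theta> t)) (at t within {0..T})"
      using bounded_linear.has_vector_derivative[OF bounded_linear_fst d1[OF t]]
        bounded_linear.has_vector_derivative[OF bounded_linear_snd d1[OF t]]
      unfolding has_real_derivative_iff_has_vector_derivative x_def y_def by simp_all
    have "norm (\<gamma>1 t) = \<sigma> t" by (simp add: \<sigma>_def x_def y_def norm_prod_def)
    then have "\<bar>x t * y' t - y t * x' t\<bar> / (\<sigma> t) ^ 3 \<le> k"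
      using curv[OF t] by (simp add: curv_def x_def y_def x'_def y'_def)
    then have "\<bar>x t * y' t - y t * x' t\<bar> \<le> (k * \<sigma> t) * (\<sigma> t)\<^sup>2"
      using sig[OF t] by (simp add: pos_divide_le_eq power2_eq_square power3_eq_cube mult.assoc)
    then show "\<bar>\<omega> t\<bar> \<le> k * \<sigma> t"
      unfolding \<omega>_def abs_divide using sig[OF t] by (simp add: pos_divide_le_eq)
  qed
  then show thesis by (rule that)
qed

lemma polar_formD:
  assumes "polar_form k T \<gamma> \<sigma> \<theta> \<omega>" "0 \<le> a" "b \<le> T" "t \<in> {a..b}"
  shows "((\<lambda>t. fst (\<gamma> t)) has_real_derivative \<sigma> t * cos (\<theta> t)) (at t within {a..b})"
    "((\<lambda>t. snd (\<gamma> t)) has_real_derivative \<sigma> t * sin (\<theta> t)) (at t within {a..b})"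
    "(\<theta> has_real_derivative \<omega> t) (at t within {a..b})"
    "0 < \<sigma> t" "\<bar>\<omega> t\<bar> \<le> k * \<sigma> t"
  using assms unfolding polar_form_def by (auto intro: DERIV_subset[where s = "{0..T}"])

lemma polar_form_continuous:
  assumes "polar_form k T \<gamma> \<sigma> \<theta> \<omega>" "0 \<le> a" "b \<le> T"
  shows "continuous_on {a..b} \<sigma>"
  using assms unfolding polar_form_def by (auto intro: continuous_on_subset)

lemma dist_le_arclength:
  assumes P: "polar_form k T \<gamma> \<sigma> \<theta> \<omega>" and ab: "0 \<le> a" "a \<le> b" "b \<le> T"
  shows "dist (\<gamma> a) (\<gamma> b) \<le> integral {a..b} \<sigma>"
proof -
  let ?d = "\<lambda>t. (\<sigma> t * cos (\<theta> t), \<sigma> t * sin (\<theta> t))"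
  have "(\<gamma> has_vector_derivative ?d t) (at t within {a..b})" if "t \<in> {a..b}" for t
    using has_vector_derivative_Pair[of "\<lambda>t. fst (\<gamma> t)" _ t "{a..b}" "\<lambda>t. snd (\<gamma> t)"]
      polar_formD(1,2)[OF P ab(1,3) that]
    by (simp add: has_real_derivative_iff_has_vector_derivative)
  then have I: "(?d has_integral (\<gamma> b - \<gamma> a)) {a..b}"
    using ab by (intro fundamental_theorem_of_calculus) auto
  have n: "norm (?d t) \<le> \<sigma> t" if "t \<in> {a..b}" for t
  proof -
    have "(\<sigma> t * cos (\<theta> t))\<^sup>2 + (\<sigma> t * sin (\<theta> t))\<^sup>2 = (\<sigma> t)\<^sup>2"
      by (simp add: power_mult_distrib flip: distrib_left)
    then show ?thesis using polar_formD(4)[OF P ab(1,3) that] by (simp add: norm_prod_def)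
  qed
  have "\<sigma> integrable_on {a..b}"
    using polar_form_continuous[OF P ab(1,3)] by (rule integrable_continuous_real)
  with I n have "norm (integral {a..b} ?d) \<le> integral {a..b} \<sigma>"
    by (intro integral_norm_bound_integral) auto
  with I show ?thesis by (simp add: integral_unique dist_norm norm_minus_commute)
qed

section \<open>Bounded length\<close>

lemma rotated_coords_sq:
  "(u * cos \<theta> + v * sin \<theta>)\<^sup>2 + (v * cos \<theta> - u * sin \<theta>)\<^sup>2 = u\<^sup>2 + (v::real)\<^sup>2"
proof -
  have "(u * cos \<theta> + v * sin \<theta>)\<^sup>2 + (v * cos \<theta> - u * sin \<theta>)\<^sup>2
      = (u\<^sup>2 + v\<^sup>2) * ((sin \<theta>)\<^sup>2 + (cos \<theta>)\<^sup>2)" by algebra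
  then show ?thesis by simp
qed

text \<open>The two expressions are the components of \<open>p - q\<close> in a frame turned by
  \<open>\<theta>\<close>, and a rotation preserves length.\<close>

lemma rotated_coords_abs_less:
  fixes p q :: pt
  assumes "dist p q < R"
  shows "\<bar>(fst p - fst q) * cos \<theta> + (snd p - snd q) * sin \<theta>\<bar> < R"
    "\<bar>(snd p - snd q) * cos \<theta> - (fst p - fst q) * sin \<theta>\<bar> < R"
proof -
  have "0 < R" using assms zero_le_dist[of p q] by linarith
  have "(fst p - fst q)\<^sup>2 + (snd p - snd q)\<^sup>2 = (dist p q)\<^sup>2"
    by (simp add: dist_prod_def dist_real_def)
  also have "\<dots> < R\<^sup>2" using assms by (intro power_strict_mono) auto
  finally have "((fst p - fst q) * cos \<theta> + (snd p - snd q) * sin \<theta>)\<^sup>2 < R\<^sup>2"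
    "((snd p - snd q) * cos \<theta> - (fst p - fst q) * sin \<theta>)\<^sup>2 < R\<^sup>2"
    using rotated_coords_sq[of "fst p - fst q" \<theta> "snd p - snd q"]
    by (smt (verit) zero_le_power2)+
  with \<open>0 < R\<close> show "\<bar>(fst p - fst q) * cos \<theta> + (snd p - snd q) * sin \<theta>\<bar> < R"
    "\<bar>(snd p - snd q) * cos \<theta> - (fst p - fst q) * sin \<theta>\<bar> < R"
    by (auto intro: power2_less_imp_less[of "\<bar>_\<bar>" R])
qed

text \<open>Differentiation in the moving frame of the curve with angle \<open>\<theta>\<close>:
  tangent and normal rotate into each other at rate \<open>\<omega>\<close>, and the second curve,
  with speed \<open>\<sigma>'\<close> and angle \<open>\<alpha>\<close>, contributes the components
  of its velocity in that frame.\<close>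

lemma tangential_deriv:
  assumes X: "(X has_real_derivative \<sigma> * cos (\<theta> t) - \<sigma>' * cos \<alpha>) (at t within S)"
    and Y: "(Y has_real_derivative \<sigma> * sin (\<theta> t) - \<sigma>' * sin \<alpha>) (at t within S)"
    and \<theta>: "(\<theta> has_real_derivative \<omega>) (at t within S)"
  shows "((\<lambda>t. X t * cos (\<theta> t) + Y t * sin (\<theta> t)) has_real_derivative
      \<sigma> + \<omega> * (Y t * cos (\<theta> t) - X t * sin (\<theta> t)) - \<sigma>' * cos (\<alpha> - \<theta> t)) (at t within S)"
    "((\<lambda>t. Y t * cos (\<theta> t) - X t * sin (\<theta> t)) has_real_derivative
      - \<sigma>' * sin (\<alpha> - \<theta> t) - \<omega> * (X t * cos (\<theta> t) + Y t * sin (\<theta> t))) (at t within S)"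
proof -
  have 1: "\<sigma> = \<sigma> * (sin (\<theta> t))\<^sup>2 + \<sigma> * (cos (\<theta> t))\<^sup>2" by (simp flip: distrib_left)
  show "((\<lambda>t. X t * cos (\<theta> t) + Y t * sin (\<theta> t)) has_real_derivative
      \<sigma> + \<omega> * (Y t * cos (\<theta> t) - X t * sin (\<theta> t)) - \<sigma>' * cos (\<alpha> - \<theta> t)) (at t within S)"
    by (subst 1) (auto intro!: derivative_eq_intros X Y \<theta> simp: cos_diff algebra_simps power2_eq_square)
  show "((\<lambda>t. Y t * cos (\<theta> t) - X t * sin (\<theta> t)) has_real_derivative
      - \<sigma>' * sin (\<alpha> - \<theta> t) - \<omega> * (X t * cos (\<theta> t) + Y t * sin (\<theta> t))) (at t within S)"
    by (auto intro!: derivative_eq_intros X Y \<theta> simp: sin_diff algebra_simps)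
qed

lemma abs_mult_le_of_abs_le:
  fixes x y :: real
  assumes "\<bar>x\<bar> \<le> a" "\<bar>y\<bar> \<le> b"
  shows "\<bar>x * y\<bar> \<le> a * b"
  using assms by (simp add: abs_mult mult_mono')

text \<open>The bound depends on the perturbation \<open>\<gamma>'\<close> in no way, only on
  \<open>k\<close>, on the speed bound \<open>G\<close> of the original curve and on the length of
  the time interval. The cone condition makes the velocity component of \<open>\<gamma>\<close>
  along \<open>\<alpha>0\<close> nonnegative, which is what the turning bound asks for.\<close>

lemma local_length_bound:
  assumes k: "0 < k"
    and P0: "polar_form k T \<gamma> \<sigma>' \<alpha> \<omega>'" and P: "polar_form k T \<gamma>' \<sigma> \<theta> \<omega>"
    and ab: "0 \<le> a" "a \<le> b" "b \<le> T"
    and small: "\<And>t. t \<in> {a..b} \<Longrightarrow> dist (\<gamma>' t) (\<gamma> t) < 1 / k"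
    and cone: "\<And>t. t \<in> {a..b} \<Longrightarrow> 0 \<le> cos (\<alpha> t - \<alpha>0)"
    and G: "\<And>t. t \<in> {a..b} \<Longrightarrow> \<sigma>' t \<le> G"
  shows "integral {a..b} \<sigma> \<le> (2 / k + G * (b - a)) * (1 + (3 * pi)\<^sup>2 / 2 + 3 * pi)"
proof -
  define X where "X t = fst (\<gamma>' t) - fst (\<gamma> t)" for t
  define Y where "Y t = snd (\<gamma>' t) - snd (\<gamma> t)" for t
  note D = polar_formD[OF P ab(1,3)] and D0 = polar_formD[OF P0 ab(1,3)]
  have dX: "(X has_real_derivative \<sigma> t * cos (\<theta> t) - \<sigma>' t * cos (\<alpha> t)) (at t within {a..b})"
    and dY: "(Y has_real_derivative \<sigma> t * sin (\<theta> t) - \<sigma>' t * sin (\<alpha> t)) (at t within {a..b})"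
    if t: "t \<in> {a..b}" for t
    unfolding X_def Y_def by (intro DERIV_diff D[OF t] D0[OF t])+
  define A where "A t = X t * cos (\<theta> t) + Y t * sin (\<theta> t)" for t
  define B where "B t = Y t * cos (\<theta> t) - X t * sin (\<theta> t)" for t
  define \<psi> where "\<psi> t = \<theta> t - \<theta> a" for t
  define H where "H = 3 * pi"
  have H: "0 \<le> H" by (simp add: H_def)
  have turn: "\<theta> t - \<alpha>0 \<le> \<theta> s - \<alpha>0 + 3 * pi" if "s \<in> {a..b}" "t \<in> {a..b}" for s t
  proof (rule turning_bound[OF k, where f = "\<lambda>t. X t * cos \<alpha>0 + Y t * sin \<alpha>0" and \<sigma> = \<sigma>
        and \<phi> = "\<lambda>t. \<theta> t - \<alpha>0" and \<omega> = \<omega> and p = "\<lambda>t. \<sigma>' t * cos (\<alpha> t - \<alpha>0)"])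
    fix t assume t: "t \<in> {a..b}"
    show "((\<lambda>t. X t * cos \<alpha>0 + Y t * sin \<alpha>0) has_real_derivative
        \<sigma> t * cos (\<theta> t - \<alpha>0) - \<sigma>' t * cos (\<alpha> t - \<alpha>0)) (at t within {a..b})"
      by (auto intro!: derivative_eq_intros dX[OF t] dY[OF t] simp: cos_diff algebra_simps)
    show "((\<lambda>t. \<theta> t - \<alpha>0) has_real_derivative \<omega> t) (at t within {a..b})"
      by (auto intro!: derivative_eq_intros D(3)[OF t])
    show "\<bar>\<omega> t\<bar> \<le> k * \<sigma> t" by (rule D(5)[OF t])
    show "0 \<le> \<sigma>' t * cos (\<alpha> t - \<alpha>0)" using cone[OF t] D0(4)[OF t] by simp
    show "\<bar>X t * cos \<alpha>0 + Y t * sin \<alpha>0\<bar> < 1 / k"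
      unfolding X_def Y_def by (rule rotated_coords_abs_less[OF small[OF t]])
  qed (fact that)+
  have \<psi>: "\<bar>\<psi> t\<bar> \<le> H" if "t \<in> {a..b}" for t
    using turn[of a t] turn[of t a] that by (auto simp: \<psi>_def H_def)
  have AB: "\<bar>A t\<bar> \<le> 1 / k" "\<bar>B t\<bar> \<le> 1 / k" if "t \<in> {a..b}" for t
    using rotated_coords_abs_less[OF small[OF that], of "\<theta> t"]
    unfolding A_def B_def X_def Y_def by simp_all
  \<comment> \<open>\<open>Q\<close> has derivative \<open>- \<omega> * \<psi>\<close>, so in the
    derivative of \<open>A * Q - B * \<psi>\<close> the terms containing \<open>A\<close> cancel.
    The constant \<open>H\<^sup>2\<close> keeps \<open>Q\<close> at least 1.\<close>
  define Q where "Q t = 1 + (H\<^sup>2 - (\<psi> t)\<^sup>2) / 2" for t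
  have Q: "1 \<le> Q t" "Q t \<le> 1 + H\<^sup>2 / 2" if "t \<in> {a..b}" for t
    using \<psi>[OF that] H abs_le_square_iff[of "\<psi> t" H] by (simp_all add: Q_def)
  \<comment> \<open>One constant serves twice: it bounds \<open>k\<close> times the function
    \<open>A * Q - B * \<psi>\<close>, and also the factor that multiplies the speed
    \<open>\<sigma>'\<close> in its derivative.\<close>
  define C where "C = 1 + H\<^sup>2 / 2 + H"
  let ?\<Phi> = "\<lambda>t. A t * Q t - B t * \<psi> t"
  have bound: "\<bar>?\<Phi> t\<bar> \<le> C / k" if t: "t \<in> {a..b}" for t
  proof -
    have "\<bar>A t * Q t\<bar> \<le> 1 / k * (1 + H\<^sup>2 / 2)" "\<bar>B t * \<psi> t\<bar> \<le> 1 / k * H"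
      using AB[OF t] Q[OF t] \<psi>[OF t] by (intro abs_mult_le_of_abs_le; simp)+
    moreover have "C / k = 1 / k * (1 + H\<^sup>2 / 2) + 1 / k * H"
      by (simp add: C_def add_divide_distrib)
    ultimately show ?thesis by linarith
  qed
  have int: "\<sigma> integrable_on {a..b}"
    using polar_form_continuous[OF P ab(1,3)] by (rule integrable_continuous_real)
  have "integral {a..b} (\<lambda>t. \<sigma> t - G * C) \<le> ?\<Phi> b - ?\<Phi> a"
  proof (rule diff_le_integral_of_deriv_ge[OF ab(2)])
    fix t assume t: "t \<in> {a..b}"
    note dAB = tangential_deriv[OF dX[OF t] dY[OF t] D(3)[OF t], folded A_def B_def]
    let ?c = "cos (\<alpha> t - \<theta> t)" and ?s = "sin (\<alpha> t - \<theta> t)"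
    have "(\<psi> has_real_derivative \<omega> t) (at t within {a..b})"
      unfolding \<psi>_def by (auto intro!: derivative_eq_intros D(3)[OF t])
    then show "(?\<Phi> has_real_derivative
        (\<sigma> t + \<omega> t * B t) * Q t - \<omega> t * B t - \<sigma>' t * (?c * Q t) + \<sigma>' t * (?s * \<psi> t)) (at t within {a..b})"
      unfolding Q_def by (auto intro!: derivative_eq_intros dAB simp: field_simps)
    \<comment> \<open>The curvature bound and the bound \<open>1 / k\<close> on the displacement
      combine to make \<open>\<sigma> + \<omega> * B\<close> nonnegative. Multiplying it by
      \<open>Q\<close> then loses nothing, and the remaining \<open>- \<omega> * B\<close> cancels
      to leave \<open>\<sigma>\<close>.\<close>
    have "\<bar>\<omega> t * B t\<bar> \<le> (k * \<sigma> t) * (1 / k)"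
      using D(5)[OF t] AB(2)[OF t] by (rule abs_mult_le_of_abs_le)
    then have "0 \<le> \<sigma> t + \<omega> t * B t" using k by simp
    then have 1: "\<sigma> t + \<omega> t * B t \<le> (\<sigma> t + \<omega> t * B t) * Q t"
      using Q(1)[OF t] mult_left_mono[of 1 "Q t"] by fastforce
    have "\<bar>?c * Q t\<bar> \<le> 1 * (1 + H\<^sup>2 / 2)" "\<bar>?s * \<psi> t\<bar> \<le> 1 * H"
      using Q[OF t] \<psi>[OF t] by (intro abs_mult_le_of_abs_le; simp)+
    then have "\<bar>?c * Q t - ?s * \<psi> t\<bar> \<le> C" by (simp add: C_def)
    then have "\<bar>\<sigma>' t * (?c * Q t - ?s * \<psi> t)\<bar> \<le> G * C"
      using G[OF t] D0(4)[OF t] by (intro abs_mult_le_of_abs_le) auto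
    then have 2: "\<sigma>' t * (?c * Q t) - \<sigma>' t * (?s * \<psi> t) \<le> G * C" by (simp add: right_diff_distrib)
    from 1 2 show "\<sigma> t - G * C
        \<le> (\<sigma> t + \<omega> t * B t) * Q t - \<omega> t * B t - \<sigma>' t * (?c * Q t) + \<sigma>' t * (?s * \<psi> t)"
      by linarith
  qed (intro integrable_diff int integrable_const_ivl)
  moreover have "integral {a..b} (\<lambda>t. \<sigma> t - G * C) = integral {a..b} \<sigma> - G * C * (b - a)"
    using ab int by (simp add: integral_diff integrable_const_ivl)
  moreover have "?\<Phi> b - ?\<Phi> a \<le> C / k + C / k"
    using bound[of a] bound[of b] ab by auto
  ultimately have "integral {a..b} \<sigma> \<le> C / k + C / k + G * C * (b - a)" by linarith
  also have "\<dots> = (2 / k + G * (b - a)) * C" by (simp add: algebra_simps)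
  finally show ?thesis by (simp add: C_def H_def)
qed

text \<open>Compactness by bisection: a uniform length bound adds up over adjacent time intervals,
  and near each time the tangent of \<open>\<gamma>\<close> stays within a quarter turn of its
  direction there, so the local bound applies.\<close>

lemma length_bound:
  assumes k: "0 < k" and T: "0 < T" and "trajectory k T \<gamma>"
  obtains L where "\<And>\<gamma>' \<sigma> \<theta> \<omega>. \<lbrakk>small_perturbation k T \<gamma> \<gamma>'; polar_form k T \<gamma>' \<sigma> \<theta> \<omega>\<rbrakk>
    \<Longrightarrow> integral {0..T} \<sigma> \<le> L"
proof -
  obtain \<sigma>' \<alpha> \<omega>' where P0: "polar_form k T \<gamma> \<sigma>' \<alpha> \<omega>'"
    using exists_polar_form assms by blast
  have "bounded (\<sigma>' ` {0..T})"
    using P0 by (intro compact_imp_bounded compact_continuous_image) (auto simp: polar_form_def)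
  then obtain G where "\<forall>x\<in>\<sigma>' ` {0..T}. norm x \<le> G" unfolding bounded_iff by blast
  then have G: "\<sigma>' t \<le> G" if "t \<in> {0..T}" for t using that by (force simp: abs_le_iff)
  have "continuous_on {0..T} \<alpha>"
    using P0 DERIV_continuous continuous_on_eq_continuous_within unfolding polar_form_def by blast
  \<comment> \<open>The bound \<open>L\<close> is chosen before the perturbation, which makes it
    uniform. The guard is there because bisection also considers intervals that leave the
    domain.\<close>
  define bdd where "bdd a b \<longleftrightarrow> (0 \<le> a \<and> b \<le> T \<longrightarrow> (\<exists>L. \<forall>\<gamma>' \<sigma> \<theta> \<omega>. small_perturbation k T \<gamma> \<gamma>' \<and>
    polar_form k T \<gamma>' \<sigma> \<theta> \<omega> \<longrightarrow> integral {a..b} \<sigma> \<le> L))" for a b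
  have "bdd 0 T"
  proof (rule Bolzano)
    fix a b c assume *: "bdd a b" "bdd b c" "a \<le> b" "b \<le> c"
    show "bdd a c"
      unfolding bdd_def
    proof
      assume ac: "0 \<le> a \<and> c \<le> T"
      with * obtain L1 L2 where L:
        "\<And>\<gamma>' \<sigma> \<theta> \<omega>. small_perturbation k T \<gamma> \<gamma>' \<Longrightarrow> polar_form k T \<gamma>' \<sigma> \<theta> \<omega> \<Longrightarrow> integral {a..b} \<sigma> \<le> L1"
        "\<And>\<gamma>' \<sigma> \<theta> \<omega>. small_perturbation k T \<gamma> \<gamma>' \<Longrightarrow> polar_form k T \<gamma>' \<sigma> \<theta> \<omega> \<Longrightarrow> integral {b..c} \<sigma> \<le> L2"
        unfolding bdd_def by (meson order_trans)
      have "integral {a..c} \<sigma> \<le> L1 + L2"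
        if "small_perturbation k T \<gamma> \<gamma>'" and P: "polar_form k T \<gamma>' \<sigma> \<theta> \<omega>" for \<gamma>' \<sigma> \<theta> \<omega>
      proof -
        have "\<sigma> integrable_on {a..c}"
          using polar_form_continuous[OF P] ac by (intro integrable_continuous_real) auto
        then have "integral {a..c} \<sigma> = integral {a..b} \<sigma> + integral {b..c} \<sigma>"
          using Henstock_Kurzweil_Integration.integral_combine[OF *(3,4)] by metis
        then show ?thesis using L(1)[OF that] L(2)[OF that] by simp
      qed
      then show "\<exists>L. \<forall>\<gamma>' \<sigma> \<theta> \<omega>. small_perturbation k T \<gamma> \<gamma>' \<and>
          polar_form k T \<gamma>' \<sigma> \<theta> \<omega> \<longrightarrow> integral {a..c} \<sigma> \<le> L" by blast
    qed
  next
    fix x assume x: "0 \<le> x" "x \<le> T"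
    then obtain d where d: "d > 0" "\<And>t. t \<in> {0..T} \<Longrightarrow> dist t x < d \<Longrightarrow> dist (\<alpha> t) (\<alpha> x) < pi / 2"
      using \<open>continuous_on {0..T} \<alpha>\<close> pi_half_gt_zero unfolding continuous_on_iff
      by (metis atLeastAtMost_iff)
    have "bdd a b" if "a \<le> x" "x \<le> b" "b - a < d" for a b
      unfolding bdd_def
    proof (intro impI exI allI)
      fix \<gamma>' \<sigma> \<theta> \<omega>
      assume ab: "0 \<le> a \<and> b \<le> T" and *: "small_perturbation k T \<gamma> \<gamma>' \<and> polar_form k T \<gamma>' \<sigma> \<theta> \<omega>"
      show "integral {a..b} \<sigma> \<le> (2 / k + G * (b - a)) * (1 + (3 * pi)\<^sup>2 / 2 + 3 * pi)"
      proof (rule local_length_bound[OF k P0, of \<gamma>' \<sigma> \<theta> \<omega> a b "\<alpha> x"])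
        fix t assume t: "t \<in> {a..b}"
        then have tT: "t \<in> {0..T}" using ab by auto
        show "dist (\<gamma>' t) (\<gamma> t) < 1 / k"
          using * tT unfolding small_perturbation_def by force
        have "dist t x < d" using t that by (auto simp: dist_real_def)
        then show "0 \<le> cos (\<alpha> t - \<alpha> x)"
          using d(2)[OF tT] unfolding dist_real_def by (intro cos_ge_zero; linarith)
        show "\<sigma>' t \<le> G" using G tT by simp
      qed (use ab * that in auto)
    qed
    then show "\<exists>d>0. \<forall>a b. a \<le> x \<and> x \<le> b \<and> b - a < d \<longrightarrow> bdd a b" using d(1) by blast
  qed (use T in simp)
  then obtain L where "\<And>\<gamma>' \<sigma> \<theta> \<omega>. small_perturbation k T \<gamma> \<gamma>' \<and> polar_form k T \<gamma>' \<sigma> \<theta> \<omega>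
      \<Longrightarrow> integral {0..T} \<sigma> \<le> L" unfolding bdd_def by blast
  then show thesis using that[of L] by blast
qed

section \<open>Stable counts\<close>

text \<open>The integers \<open>\<lfloor>g x / d\<rfloor>\<close> are pairwise distinct and lie
  between 0 and \<open>\<lfloor>L / d\<rfloor>\<close>.\<close>

lemma ecount_le_of_separated:
  fixes g :: "'a \<Rightarrow> real"
  assumes d: "0 < d" and range: "\<And>x. x \<in> A \<Longrightarrow> 0 \<le> g x \<and> g x \<le> L"
    and sep: "\<And>x y. \<lbrakk>x \<in> A; y \<in> A; x \<noteq> y\<rbrakk> \<Longrightarrow> d \<le> \<bar>g x - g y\<bar>"
  shows "ecount A \<le> enat (nat (\<lfloor>L / d\<rfloor> + 1))"
proof -
  let ?h = "\<lambda>x. \<lfloor>g x / d\<rfloor>"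
  have inj: "inj_on ?h A"
  proof (rule inj_onI, rule ccontr)
    fix x y assume *: "x \<in> A" "y \<in> A" "?h x = ?h y" "x \<noteq> y"
    then have "\<bar>g x / d - g y / d\<bar> < 1" by linarith
    then have "\<bar>g x - g y\<bar> < d"
      using d by (simp add: abs_less_iff field_simps)
    with sep * show False by fastforce
  qed
  have sub: "?h ` A \<subseteq> {0..\<lfloor>L / d\<rfloor>}"
    using range d by (auto intro!: floor_mono divide_right_mono)
  then have fin: "finite A" using inj finite_imageD finite_subset by blast
  have "card A = card (?h ` A)" using inj by (simp add: card_image)
  also have "\<dots> \<le> card {0..\<lfloor>L / d\<rfloor>}" using sub by (intro card_mono) auto
  finally show ?thesis using fin by (simp add: ecount_def)
qed

text \<open>A trajectory is a small perturbation of itself, so a uniform bound on the counts of all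
  perturbations also bounds the original count and hence both differences.\<close>

lemma stable_of_bounded:
  assumes "0 < k" and
    "\<And>T \<gamma>. \<lbrakk>0 < T; trajectory k T \<gamma>\<rbrakk> \<Longrightarrow>
      \<exists>M. \<forall>\<gamma>' x. small_perturbation k T \<gamma> \<gamma>' \<longrightarrow> C T \<gamma>' x \<le> enat M"
  shows "stable k C"
  unfolding stable_def
proof (intro allI impI)
  fix T \<gamma> assume *: "T > 0 \<and> trajectory k T \<gamma>"
  then obtain M where M: "\<And>\<gamma>' x. small_perturbation k T \<gamma> \<gamma>' \<Longrightarrow> C T \<gamma>' x \<le> enat M"
    using assms(2) by blast
  have "small_perturbation k T \<gamma> \<gamma>"
    using * assms(1) by (auto simp: small_perturbation_def intro!: exI[of _ 0])
  with M show "\<exists>M. \<forall>\<gamma>' x. small_perturbation k T \<gamma> \<gamma>' \<longrightarrow>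
      C T \<gamma>' x \<le> C T \<gamma> x + enat M \<and> C T \<gamma> x \<le> C T \<gamma>' x + enat M"
    by (meson le_iff_add order_trans add_increasing zero_le)
qed

text \<open>Common frame for both stable counts: each counted object is placed at a time
  \<open>pos\<close>, and the curve moves a distance at least \<open>d\<close> between two of them.
  The arc lengths travelled up to these times are then \<open>d\<close> apart within a total length
  that is bounded over all perturbations.\<close>

lemma stable_of_arclength_separated:
  fixes pos :: "real \<Rightarrow> (real \<Rightarrow> pt) \<Rightarrow> pt \<Rightarrow> 'a \<Rightarrow> real"
  assumes k: "0 < k" and d: "0 < d"
    and range: "\<And>T \<gamma> x i. i \<in> A T \<gamma> x \<Longrightarrow> pos T \<gamma> x i \<in> {0..T}"
    and sep: "\<And>T \<gamma> \<sigma> \<theta> \<omega> x i j. \<lbrakk>polar_form k T \<gamma> \<sigma> \<theta> \<omega>; i \<in> A T \<gamma> x; j \<in> A T \<gamma> x; i \<noteq> j;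
        pos T \<gamma> x i \<le> pos T \<gamma> x j\<rbrakk>
      \<Longrightarrow> \<exists>u\<in>{pos T \<gamma> x i..pos T \<gamma> x j}. d \<le> dist (\<gamma> (pos T \<gamma> x i)) (\<gamma> u)"
  shows "stable k (\<lambda>T \<gamma> x. ecount (A T \<gamma> x))"
proof (rule stable_of_bounded[OF k])
  fix T \<gamma> assume T: "0 < T" and "trajectory k T \<gamma>"
  then obtain L where L: "\<And>\<gamma>' \<sigma> \<theta> \<omega>. \<lbrakk>small_perturbation k T \<gamma> \<gamma>'; polar_form k T \<gamma>' \<sigma> \<theta> \<omega>\<rbrakk>
      \<Longrightarrow> integral {0..T} \<sigma> \<le> L" using length_bound k by metis
  have "ecount (A T \<gamma>' x) \<le> enat (nat (\<lfloor>L / d\<rfloor> + 1))"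
    if pert: "small_perturbation k T \<gamma> \<gamma>'" for \<gamma>' x
  proof -
    obtain \<sigma> \<theta> \<omega> where P: "polar_form k T \<gamma>' \<sigma> \<theta> \<omega>"
      using pert T exists_polar_form unfolding small_perturbation_def by metis
    let ?p = "pos T \<gamma>' x"
    have int: "\<sigma> integrable_on {a..b}" if "0 \<le> a" "b \<le> T" for a b
      using polar_form_continuous[OF P that] by (rule integrable_continuous_real)
    have split: "integral {0..b} \<sigma> = integral {0..a} \<sigma> + integral {a..b} \<sigma>" if "0 \<le> a" "a \<le> b" "b \<le> T" for a b
      using Henstock_Kurzweil_Integration.integral_combine[OF that(1,2) int] that(3) by simp
    have nonneg: "0 \<le> integral {a..b} \<sigma>" if "0 \<le> a" "b \<le> T" for a b
      using that polar_formD(4)[OF P that] by (intro integral_nonneg int) force+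
    have far: "d \<le> integral {0..?p j} \<sigma> - integral {0..?p i} \<sigma>"
      if ij: "i \<in> A T \<gamma>' x" "j \<in> A T \<gamma>' x" "i \<noteq> j" "?p i \<le> ?p j" for i j
    proof -
      obtain u where u: "?p i \<le> u" "u \<le> ?p j" "d \<le> dist (\<gamma>' (?p i)) (\<gamma>' u)"
        using sep[OF P ij] by auto
      have r: "0 \<le> ?p i" "?p j \<le> T" using range ij by auto
      have "d \<le> integral {?p i..u} \<sigma>"
        using dist_le_arclength[OF P, of "?p i" u] u r by linarith
      moreover have "integral {0..?p j} \<sigma> = integral {0..?p i} \<sigma> + integral {?p i..u} \<sigma> + integral {u..?p j} \<sigma>"
        using split[of "?p i" u] split[of u "?p j"] u r by linarith
      moreover have "0 \<le> integral {u..?p j} \<sigma>" using nonneg[of u "?p j"] u r by linarith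
      ultimately show ?thesis by linarith
    qed
    show ?thesis
    proof (rule ecount_le_of_separated[OF d, where g = "\<lambda>i. integral {0..?p i} \<sigma>"])
      fix i assume "i \<in> A T \<gamma>' x"
      then have r: "0 \<le> ?p i" "?p i \<le> T" using range by auto
      have "integral {0..T} \<sigma> = integral {0..?p i} \<sigma> + integral {?p i..T} \<sigma>" using split[of "?p i" T] r by simp
      then show "0 \<le> integral {0..?p i} \<sigma> \<and> integral {0..?p i} \<sigma> \<le> L"
        using L[OF pert P] nonneg[of 0 "?p i"] nonneg[of "?p i" T] r by simp
    next
      fix i j assume "i \<in> A T \<gamma>' x" "j \<in> A T \<gamma>' x" "i \<noteq> j"
      then show "d \<le> \<bar>integral {0..?p i} \<sigma> - integral {0..?p j} \<sigma>\<bar>"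
        using far[of i j] far[of j i] by (cases "?p i \<le> ?p j") auto
    qed
  qed
  then show "\<exists>M. \<forall>\<gamma>' x. small_perturbation k T \<gamma> \<gamma>' \<longrightarrow> ecount (A T \<gamma>' x) \<le> enat M" by blast
qed

text \<open>If the two intervals meet, their union is an interval mapped into \<open>K\<close>, so
  maximality keeps the second one from sticking out.\<close>

lemma maxints_absorb:
  assumes "(a, b) \<in> maxints T \<gamma> K" "0 \<le> c" "d \<le> T" "\<gamma> ` {c..d} \<subseteq> K" "c \<le> b" "a \<le> d"
  shows "a \<le> c" "d \<le> b"
proof -
  have m: "\<And>a' b'. 0 \<le> a' \<and> a' \<le> a \<and> b \<le> b' \<and> b' \<le> T \<and> \<gamma> ` {a'..b'} \<subseteq> K \<Longrightarrow> a' = a \<and> b' = b"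
    and ab: "0 \<le> a" "a \<le> b" "b \<le> T" "\<gamma> ` {a..b} \<subseteq> K"
    using assms(1) unfolding maxints_def by auto
  have "{min a c..max b d} \<subseteq> {a..b} \<union> {c..d}" using assms(5,6) ab(2) by auto
  then have "\<gamma> ` {min a c..max b d} \<subseteq> K" using ab(4) assms(4) by blast
  with m[of "min a c" "max b d"] ab assms(2,3) show "a \<le> c" "d \<le> b" by auto
qed

text \<open>Otherwise \<open>{a1..b2}\<close> would be mapped into \<open>K\<close>, and absorption
  would make the two maximal intervals equal.\<close>

lemma maxints_exit_between:
  assumes 1: "(a1, b1) \<in> maxints T \<gamma> K" and 2: "(a2, b2) \<in> maxints T \<gamma> K"
    and "(a1, b1) \<noteq> (a2, b2)" "a1 \<le> a2"
  obtains t where "t \<in> {a1..a2}" "\<gamma> t \<notin> K"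
proof (rule ccontr)
  assume "\<not> thesis"
  with that have in_K: "\<gamma> ` {a1..a2} \<subseteq> K" by blast
  have ab: "0 \<le> a1" "a1 \<le> b1" "b1 \<le> T" "\<gamma> ` {a1..b1} \<subseteq> K" "0 \<le> a2" "a2 \<le> b2" "b2 \<le> T" "\<gamma> ` {a2..b2} \<subseteq> K"
    using 1 2 unfolding maxints_def by auto
  have "{a1..b2} \<subseteq> {a1..a2} \<union> {a2..b2}" by auto
  then have "\<gamma> ` {a1..b2} \<subseteq> K" using in_K ab by blast
  from maxints_absorb[OF 1 _ _ this] maxints_absorb[OF 2 _ _ this] ab assms(4)
  have "a2 = a1" "b2 \<le> b1" by auto
  moreover from maxints_absorb(2)[OF 2 ab(1,3,4)] ab \<open>a2 = a1\<close> have "b1 \<le> b2" by auto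
  ultimately show False using assms(3) by auto
qed

text \<open>With \<open>q = \<gamma> - x\<close>, the tangential component of \<open>q\<close> is nondecreasing as long as \<open>k |q| \<le> 1\<close>,
  so \<open>|q|\<close> has no local maximum below \<open>1 / k\<close>.\<close>

lemma excursion_leaves_curvature_disk:
  assumes k: "0 < k" and P: "polar_form k T \<gamma> \<sigma> \<theta> \<omega>" and ab: "0 \<le> a" "b \<le> T"
    and ends: "dist (\<gamma> a) x \<le> r" "dist (\<gamma> b) x \<le> r" and t: "t \<in> {a..b}" "r < dist (\<gamma> t) x"
  obtains u where "u \<in> {a..b}" "1 / k \<le> dist (\<gamma> u) x"
proof (rule ccontr)
  assume "\<not> thesis"
  with that have small: "dist (\<gamma> u) x < 1 / k" if "u \<in> {a..b}" for u
    using that by (meson not_less)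
  define X where "X t = fst (\<gamma> t) - fst x" for t
  define Y where "Y t = snd (\<gamma> t) - snd x" for t
  define A where "A t = X t * cos (\<theta> t) + Y t * sin (\<theta> t)" for t
  define h where "h t = (X t)\<^sup>2 + (Y t)\<^sup>2" for t
  note D = polar_formD[OF P ab]
  have dX: "(X has_real_derivative \<sigma> t * cos (\<theta> t)) (at t within {a..b})"
    and dY: "(Y has_real_derivative \<sigma> t * sin (\<theta> t)) (at t within {a..b})"
    if t: "t \<in> {a..b}" for t
    unfolding X_def Y_def by (auto intro!: derivative_eq_intros D(1,2)[OF t])
  have dh: "(h has_real_derivative 2 * \<sigma> t * A t) (at t within {a..b})" if t: "t \<in> {a..b}" for t
    unfolding h_def A_def
    by (auto intro!: derivative_eq_intros dX[OF t] dY[OF t] simp: algebra_simps)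
  have mono: "A u \<le> A v" if "u \<in> {a..b}" "v \<in> {a..b}" "u \<le> v" for u v
  proof (rule le_of_deriv_nonneg_within[OF that(3)])
    fix w assume "w \<in> {u..v}"
    then have w: "w \<in> {a..b}" and sub: "{u..v} \<subseteq> {a..b}" using that by auto
    let ?B = "Y w * cos (\<theta> w) - X w * sin (\<theta> w)"
    have "(A has_real_derivative \<sigma> w + \<omega> w * ?B) (at w within {a..b})"
      \<comment> \<open>The centre \<open>x\<close> is treated as a second curve of speed 0.\<close>
      using tangential_deriv(1)[of X "\<sigma> w" \<theta> w 0 0 "{a..b}" Y "\<omega> w"] dX[OF w] dY[OF w] D(3)[OF w]
      unfolding A_def by simp
    then show "(A has_real_derivative \<sigma> w + \<omega> w * ?B) (at w within {u..v})"
      using sub by (rule DERIV_subset)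
    have "\<bar>?B\<bar> \<le> 1 / k"
      using rotated_coords_abs_less(2)[OF small[OF w], of "\<theta> w"] by (simp add: X_def Y_def)
    with D(5)[OF w] have "\<bar>\<omega> w * ?B\<bar> \<le> (k * \<sigma> w) * (1 / k)" by (rule abs_mult_le_of_abs_le)
    then show "0 \<le> \<sigma> w + \<omega> w * ?B" using k by simp
  qed
  have h_dist: "h u = (dist (\<gamma> u) x)\<^sup>2" for u
    by (simp add: h_def X_def Y_def dist_prod_def dist_real_def)
  have "0 \<le> r" using ends(1) zero_le_dist order_trans by blast
  then have "h a < h t" "h b < h t"
    unfolding h_dist using ends t(2) by (auto intro!: power_strict_mono)
  \<comment> \<open>\<open>A\<close> has the sign of the derivative of the squared distance
    \<open>h\<close>. By monotonicity, \<open>A t \<le> 0\<close> makes \<open>h\<close>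
    nonincreasing before \<open>t\<close>, and \<open>A t > 0\<close> makes it nondecreasing after
    \<open>t\<close>; either way an endpoint is as far from \<open>x\<close> as
    \<open>t\<close>.\<close>
  have "\<not> A t \<le> 0"
  proof
    assume "A t \<le> 0"
    have "- h a \<le> - h t"
    proof (rule le_of_deriv_nonneg_within[where f = "\<lambda>t. - h t"])
      fix w assume w: "w \<in> {a..t}"
      then have w': "w \<in> {a..b}" and sub: "{a..t} \<subseteq> {a..b}" using t by auto
      show "((\<lambda>t. - h t) has_real_derivative - (2 * \<sigma> w * A w)) (at w within {a..t})"
        by (intro DERIV_minus DERIV_subset[OF dh[OF w'] sub])
      show "0 \<le> - (2 * \<sigma> w * A w)"
        using mono[OF w' t(1)] w \<open>A t \<le> 0\<close> D(4)[OF w'] by (simp add: mult_le_0_iff)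
    qed (use t in auto)
    with \<open>h a < h t\<close> show False by simp
  qed
  have "h t \<le> h b"
  proof (rule le_of_deriv_nonneg_within[where f = h])
    fix w assume w: "w \<in> {t..b}"
    then have w': "w \<in> {a..b}" and sub: "{t..b} \<subseteq> {a..b}" using t by auto
    show "(h has_real_derivative 2 * \<sigma> w * A w) (at w within {t..b})"
      by (intro DERIV_subset[OF dh[OF w'] sub])
    show "0 \<le> 2 * \<sigma> w * A w"
      using mono[OF t(1) w'] w \<open>\<not> A t \<le> 0\<close> D(4)[OF w'] by simp
  qed (use t in auto)
  with \<open>h b < h t\<close> show False by simp
qed

text \<open>Intervals are placed at their left ends. The curve leaves the disk between two of them,
  hence reaches distance \<open>1 / k\<close> from the centre, which gives the separation
  \<open>1 / k - r\<close>.\<close>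

lemma stable_disk_count:
  assumes k: "0 < k" and r: "r < 1 / k"
  shows "stable k (disk_count r)"
proof -
  have "stable k (\<lambda>T \<gamma> x. ecount (maxints T \<gamma> (disk r x)))"
  proof (rule stable_of_arclength_separated[where pos = "\<lambda>_ _ _ i. fst i", OF k])
    fix T :: real and \<gamma> \<sigma> \<theta> \<omega> x and i j :: "real \<times> real"
    assume P: "polar_form k T \<gamma> \<sigma> \<theta> \<omega>"
      and ij: "i \<in> maxints T \<gamma> (disk r x)" "j \<in> maxints T \<gamma> (disk r x)" "i \<noteq> j" "fst i \<le> fst j"
    obtain t where t: "t \<in> {fst i..fst j}" "\<gamma> t \<notin> disk r x"
      using maxints_exit_between[of "fst i" "snd i" T \<gamma> "disk r x" "fst j" "snd j"] ij by auto
    have r': "0 \<le> fst i" "fst j \<le> T" "dist (\<gamma> (fst i)) x \<le> r" "dist (\<gamma> (fst j)) x \<le> r"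
      using ij unfolding maxints_def disk_def by (auto simp: dist_commute image_subset_iff)
    obtain u where "u \<in> {fst i..fst j}" "1 / k \<le> dist (\<gamma> u) x"
      using excursion_leaves_curvature_disk[OF k P r' t(1)] t(2) by (auto simp: disk_def dist_commute)
    moreover from this have "1 / k - r \<le> dist (\<gamma> (fst i)) (\<gamma> u)"
      using r'(3) dist_triangle[of "\<gamma> u" x "\<gamma> (fst i)"] by (simp add: dist_commute)
    ultimately show "\<exists>u\<in>{fst i..fst j}. 1 / k - r \<le> dist (\<gamma> (fst i)) (\<gamma> u)" by blast
  qed (use r in \<open>auto simp: maxints_def\<close>)
  then show ?thesis by (simp add: disk_count_def[abs_def])
qed

text \<open>A maximal interval of the larger square that contains the first interval absorbs the
  connecting piece of the curve and with it the second interval. Writing \<open>min\<close> and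
  \<open>max\<close> allows either order of the left ends, so equality of the classes follows by
  exchanging roles.\<close>

lemma robust_rel_Image_subset:
  assumes r: "r1 < r2"
    and 1: "(a1, b1) \<in> maxints T \<gamma> (square r1 x)" and 2: "(a2, b2) \<in> maxints T \<gamma> (square r1 x)"
    and in_K: "\<gamma> ` {min a1 a2..max a1 a2} \<subseteq> square r2 x"
  shows "robust_rel r1 r2 T \<gamma> x `` {(a1, b1)} \<subseteq> robust_rel r1 r2 T \<gamma> x `` {(a2, b2)}"
proof
  fix i assume "i \<in> robust_rel r1 r2 T \<gamma> x `` {(a1, b1)}"
  then obtain c d a b where i: "i = (c, d)" "(c, d) \<in> maxints T \<gamma> (square r1 x)"
    and ab: "(a, b) \<in> maxints T \<gamma> (square r2 x)" "{a1..b1} \<union> {c..d} \<subseteq> {a..b}"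
    unfolding robust_rel_def by auto
  have sq: "square r1 x \<subseteq> square r2 x" using r by (auto simp: square_def)
  have m: "0 \<le> a1" "a1 \<le> b1" "b1 \<le> T" "0 \<le> a2" "a2 \<le> b2" "b2 \<le> T"
    "\<gamma> ` {a1..b1} \<subseteq> square r2 x" "\<gamma> ` {a2..b2} \<subseteq> square r2 x"
    using 1 2 sq unfolding maxints_def by auto
  have "{min a1 a2..b2} \<subseteq> {min a1 a2..max a1 a2} \<union> {a2..b2}" by auto
  then have "\<gamma> ` {min a1 a2..b2} \<subseteq> square r2 x" using in_K m(8) by blast
  \<comment> \<open>Extending up to \<open>a1\<close> guarantees that the piece meets
    \<open>{a..b}\<close>, as absorption requires, even if the second interval ends before the first
    one begins.\<close>
  with in_K have "\<gamma> ` {min a1 a2..max b2 a1} \<subseteq> square r2 x"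
    using m(5) by (cases "b2 \<le> a1") (auto simp: max_def split: if_splits)
  from maxints_absorb[OF ab(1) _ _ this] have "a \<le> min a1 a2" "max b2 a1 \<le> b"
    using m ab(2) by auto
  then have "{a2..b2} \<union> {c..d} \<subseteq> {a..b}" using ab(2) by auto
  then show "i \<in> robust_rel r1 r2 T \<gamma> x `` {(a2, b2)}"
    using 2 i ab(1) unfolding robust_rel_def by auto
qed

lemma robust_rel_Image_eq:
  assumes "r1 < r2" "i \<in> maxints T \<gamma> (square r1 x)" "j \<in> maxints T \<gamma> (square r1 x)" "fst i \<le> fst j"
    and "\<gamma> ` {fst i..fst j} \<subseteq> square r2 x"
  shows "robust_rel r1 r2 T \<gamma> x `` {i} = robust_rel r1 r2 T \<gamma> x `` {j}"
  using robust_rel_Image_subset[OF assms(1), of "fst i" "snd i" T \<gamma> x "fst j" "snd j"]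
    robust_rel_Image_subset[OF assms(1), of "fst j" "snd j" T \<gamma> x "fst i" "snd i"] assms(2-5)
  by (simp add: min_absorb1 min_absorb2 max_absorb1 max_absorb2 subset_antisym)

lemma square_exit_dist:
  assumes "p \<in> square r1 x" "q \<notin> square r2 x"
  shows "r2 - r1 \<le> dist p q"
proof -
  have "dist (fst p) (fst q) \<le> dist p q" "dist (snd p) (snd q) \<le> dist p q"
    by (rule dist_fst_le, rule dist_snd_le)
  with assms show ?thesis unfolding square_def dist_real_def by (auto simp: max_def split: if_splits)
qed

text \<open>Each class is placed at the left end of a chosen representative. Representatives of
  different classes are not joined inside the larger square, and crossing from the smaller square to
  its outside costs \<open>r2 - r1\<close>.\<close>

lemma stable_robust_count:
  assumes k: "0 < k" and r: "r1 < r2"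
  shows "stable k (robust_count r1 r2)"
proof -
  define rep where "rep T \<gamma> x c = (SOME i. i \<in> maxints T \<gamma> (square r1 x) \<and>
    robust_rel r1 r2 T \<gamma> x `` {i} = c)" for T \<gamma> x c
  have rep: "rep T \<gamma> x c \<in> maxints T \<gamma> (square r1 x) \<and> robust_rel r1 r2 T \<gamma> x `` {rep T \<gamma> x c} = c"
    if c: "c \<in> maxints T \<gamma> (square r1 x) // robust_rel r1 r2 T \<gamma> x" for T \<gamma> x c
  proof -
    obtain i where "i \<in> maxints T \<gamma> (square r1 x)" "c = robust_rel r1 r2 T \<gamma> x `` {i}"
      using c unfolding quotient_def by blast
    then have "\<exists>i. i \<in> maxints T \<gamma> (square r1 x) \<and> robust_rel r1 r2 T \<gamma> x `` {i} = c" by blast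
    then show ?thesis unfolding rep_def by (rule someI_ex)
  qed
  have "stable k (\<lambda>T \<gamma> x. ecount (maxints T \<gamma> (square r1 x) // robust_rel r1 r2 T \<gamma> x))"
  proof (rule stable_of_arclength_separated[where pos = "\<lambda>T \<gamma> x c. fst (rep T \<gamma> x c)" and d = "r2 - r1", OF k])
    fix T \<gamma> x c assume "c \<in> maxints T \<gamma> (square r1 x) // robust_rel r1 r2 T \<gamma> x"
    from rep[OF this] show "fst (rep T \<gamma> x c) \<in> {0..T}" by (auto simp: maxints_def)
  next
    fix T :: real and \<gamma> x c d
    assume cd: "c \<in> maxints T \<gamma> (square r1 x) // robust_rel r1 r2 T \<gamma> x"
        "d \<in> maxints T \<gamma> (square r1 x) // robust_rel r1 r2 T \<gamma> x" "c \<noteq> d"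
      and le: "fst (rep T \<gamma> x c) \<le> fst (rep T \<gamma> x d)"
    obtain u where u: "u \<in> {fst (rep T \<gamma> x c)..fst (rep T \<gamma> x d)}" "\<gamma> u \<notin> square r2 x"
      using robust_rel_Image_eq[OF r _ _ le] rep[OF cd(1)] rep[OF cd(2)] cd(3) by blast
    moreover have "\<gamma> (fst (rep T \<gamma> x c)) \<in> square r1 x"
      using rep[OF cd(1)] by (auto simp: maxints_def image_subset_iff)
    ultimately show "\<exists>u\<in>{fst (rep T \<gamma> x c)..fst (rep T \<gamma> x d)}. r2 - r1 \<le> dist (\<gamma> (fst (rep T \<gamma> x c))) (\<gamma> u)"
      using square_exit_dist by blast
  qed (use r in auto)
  then show ?thesis by (simp add: robust_count_def[abs_def])
qed

section \<open>Instability of the square count\<close>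

lemma curv_graph_le: "curv (1, v) (0, w) \<le> \<bar>w\<bar>"
proof -
  have "1 \<le> norm (1::real, v)" by (simp add: norm_prod_def)
  then have "1 \<le> norm (1::real, v) ^ 3" by (rule one_le_power)
  moreover have "(1::real, v) \<noteq> 0" by (simp add: zero_prod_def)
  ultimately show ?thesis
    using divide_left_mono[of 1 "norm (1::real, v) ^ 3" "\<bar>w\<bar>"] by (simp add: curv_def)
qed

text \<open>The amplitude of the second derivative is \<open>\<bar>A\<bar> * w\<^sup>2\<close>. The
  case \<open>A = 0\<close> covers the unperturbed segment.\<close>

lemma trajectory_sine:
  assumes "\<bar>A\<bar> * w\<^sup>2 \<le> k"
  shows "trajectory k T (\<lambda>t. (t, A * sin (w * t)))"
  unfolding trajectory_def
proof (intro exI conjI ballI)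
  let ?\<gamma>1 = "\<lambda>t. (1::real, A * w * cos (w * t))" and ?\<gamma>2 = "\<lambda>t. (0::real, - (A * w\<^sup>2 * sin (w * t)))"
  show "continuous_on {0..T} ?\<gamma>2" by (intro continuous_intros)
  fix t
  have 1: "((\<lambda>t. A * sin (w * t)) has_real_derivative A * w * cos (w * t)) (at t within {0..T})"
    and 2: "((\<lambda>t. A * w * cos (w * t)) has_real_derivative - (A * w\<^sup>2 * sin (w * t))) (at t within {0..T})"
    by (auto intro!: derivative_eq_intros simp: power2_eq_square)
  show "((\<lambda>t. (t, A * sin (w * t))) has_vector_derivative ?\<gamma>1 t) (at t within {0..T})"
    using 1 by (intro has_vector_derivative_Pair)
      (auto simp: has_real_derivative_iff_has_vector_derivative[symmetric] intro!: derivative_eq_intros)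
  show "(?\<gamma>1 has_vector_derivative ?\<gamma>2 t) (at t within {0..T})"
    using 2 by (intro has_vector_derivative_Pair)
      (auto simp: has_real_derivative_iff_has_vector_derivative[symmetric] intro!: derivative_eq_intros)
  show "?\<gamma>1 t \<noteq> 0" by (simp add: prod_eq_iff)
  have "curv (?\<gamma>1 t) (?\<gamma>2 t) \<le> \<bar>- (A * w\<^sup>2 * sin (w * t))\<bar>" by (rule curv_graph_le)
  also have "\<dots> \<le> \<bar>A\<bar> * w\<^sup>2 * 1" unfolding abs_minus_cancel abs_mult by (intro mult_mono) auto
  finally show "curv (?\<gamma>1 t) (?\<gamma>2 t) \<le> k" using assms by simp
qed

text \<open>The centre \<open>(r, - r)\<close> puts the upper side of the square on the horizontal
  axis over \<open>{0..2 * r}\<close>; \<open>A \<le> 2 * r\<close> keeps the wave above the lower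
  side.\<close>

lemma sine_in_square_iff:
  assumes "0 < A" "A \<le> 2 * r" "t \<in> {0..2 * r}"
  shows "(t, A * sin z) \<in> square r (r, - r) \<longleftrightarrow> sin z \<le> 0"
proof -
  have "A * (-1) \<le> A * sin z" using assms(1) by (intro mult_left_mono) auto
  then have "- (2 * r) \<le> A * sin z" using assms(2) by linarith
  moreover have "A * sin z \<le> 0 \<longleftrightarrow> sin z \<le> 0" using assms(1) by (simp add: mult_le_0_iff)
  ultimately show ?thesis using assms(3) by (auto simp: square_def abs_le_iff)
qed

text \<open>The interval is the half wave of period \<open>j\<close> below the axis. The sine is
  positive on both neighbouring half waves, so any extension inside the domain leaves the
  square.\<close>

lemma sine_maxints:
  assumes A: "0 < A" "A \<le> 2 * r" and w: "0 < w" "w * (2 * r) = 2 * pi * real m" and j: "j < m"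
  shows "((2 * real j + 1) * pi / w, (2 * real j + 2) * pi / w)
    \<in> maxints (2 * r) (\<lambda>t. (t, A * sin (w * t))) (square r (r, - r))"
proof -
  let ?a = "(2 * real j + 1) * pi / w" and ?b = "(2 * real j + 2) * pi / w"
  let ?\<gamma> = "\<lambda>t. (t, A * sin (w * t))"
  have r: "2 * r = 2 * pi * real m / w" using w by (simp add: field_simps)
  have per: "sin (z + 2 * pi * real n) = sin z" for z n
    using sin_2npi[of n] cos_2npi[of n] by (simp add: sin_add mult_ac)
  have a: "0 \<le> ?a" "?a \<le> ?b" using w by (auto intro!: divide_right_mono mult_right_mono)
  have b: "?b \<le> 2 * r"
    unfolding r using w j by (intro divide_right_mono) auto
  have le0: "sin (w * t) \<le> 0" if "t \<in> {?a..?b}" for t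
  proof -
    have "(2 * real j + 1) * pi \<le> w * t" "w * t \<le> (2 * real j + 2) * pi"
      using that w(1) by (auto simp: field_simps)
    then have "0 \<le> sin (w * t - pi - 2 * pi * real j)"
      by (intro sin_ge_zero) (auto simp: algebra_simps)
    moreover have "sin (w * t) = - sin (w * t - pi - 2 * pi * real j)"
      using per[of "w * t - 2 * pi * real j" j] per[of "w * t - pi - 2 * pi * real j" j]
      by (simp add: sin_diff)
    ultimately show ?thesis by simp
  qed
  have pos: "0 < sin (w * t)" if "2 * pi * real n < w * t" "w * t < 2 * pi * real n + pi" for t n
    using per[of "w * t - 2 * pi * real n" n] sin_gt_zero[of "w * t - 2 * pi * real n"] that by simp
  have iff: "?\<gamma> t \<in> square r (r, - r) \<longleftrightarrow> sin (w * t) \<le> 0" if "0 \<le> t" "t \<le> 2 * r" for t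
    using sine_in_square_iff[OF A] that by simp
  have "a' = ?a \<and> b' = ?b"
    if *: "0 \<le> a'" "a' \<le> ?a" "?b \<le> b'" "b' \<le> 2 * r" "?\<gamma> ` {a'..b'} \<subseteq> square r (r, - r)" for a' b'
  proof (rule ccontr)
    assume "\<not> (a' = ?a \<and> b' = ?b)"
    then consider "a' < ?a" | "?b < b'" using * by linarith
    then show False
    proof cases
      case 1
      moreover have "2 * pi * real j / w < ?a"
        using w(1) by (auto intro!: divide_strict_right_mono simp: algebra_simps)
      ultimately obtain t where t: "a' < t" "t < ?a" "2 * pi * real j / w < t"
        using dense[of "max a' (2 * pi * real j / w)" ?a] by auto
      have "0 < sin (w * t)"
        by (rule pos[of j]) (use t w(1) in \<open>auto simp: field_simps\<close>)
      moreover have "sin (w * t) \<le> 0"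
        using iff[of t] *(5) t a b * by (auto simp: image_subset_iff)
      ultimately show False by simp
    next
      case 2
      moreover have "?b < (2 * real j + 3) * pi / w"
        using w(1) by (auto intro!: divide_strict_right_mono simp: algebra_simps)
      ultimately obtain t where t: "t < b'" "?b < t" "t < (2 * real j + 3) * pi / w"
        using dense[of ?b "min b' ((2 * real j + 3) * pi / w)"] by auto
      have "0 < sin (w * t)"
        \<comment> \<open>The half wave to the right already belongs to the next period.\<close>
        by (rule pos[of "Suc j"]) (use t w(1) in \<open>auto simp: field_simps\<close>)
      moreover have "sin (w * t) \<le> 0"
        using iff[of t] *(5) t a b * by (auto simp: image_subset_iff)
      ultimately show False by simp
    qed
  qed
  moreover have "?\<gamma> ` {?a..?b} \<subseteq> square r (r, - r)"
    using iff le0 a b by (auto simp del: atLeastAtMost_iff intro!: iff[THEN iffD2]) auto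
  ultimately show ?thesis using a b unfolding maxints_def by blast
qed

lemma ecount_ge_card:
  assumes "B \<subseteq> A" "finite B"
  shows "enat (card B) \<le> ecount A"
  using assms by (auto simp: ecount_def card_mono)

lemma square_count_unstable:
  assumes k: "0 < k" and r: "0 < r"
  shows "\<not> stable k (square_count r)"
proof
  assume "stable k (square_count r)"
  define \<gamma> :: "real \<Rightarrow> pt" where "\<gamma> t = (t, 0)" for t
  define T where "T = 2 * r"
  have traj: "trajectory k T \<gamma>"
    using trajectory_sine[of 0 0 k T] k by (simp add: \<gamma>_def[abs_def])
  have T: "0 < T" using r by (simp add: T_def)
  obtain M where M: "\<And>\<gamma>' x. small_perturbation k T \<gamma> \<gamma>' \<Longrightarrow>
      square_count r T \<gamma>' x \<le> square_count r T \<gamma> x + enat M"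
    using \<open>stable k (square_count r)\<close> T traj unfolding stable_def by blast
  have in_sq: "\<gamma> ` {0..T} \<subseteq> square r (r, - r)"
    using r by (auto simp: square_def \<gamma>_def T_def abs_le_iff)
  have "i = (0, T)" if "i \<in> maxints T \<gamma> (square r (r, - r))" for i
  proof -
    obtain a b where i: "i = (a, b)" by (cases i)
    have "0 \<le> a" "a \<le> b" "b \<le> T" using that unfolding maxints_def i by auto
    then show ?thesis
      using maxints_absorb[OF that[unfolded i] _ _ in_sq] i by auto
  qed
  then have sub: "maxints T \<gamma> (square r (r, - r)) \<subseteq> {(0, T)}" by blast
  have one: "square_count r T \<gamma> (r, - r) \<le> enat 1"
    using card_mono[OF _ sub] finite_subset[OF sub] by (simp add: square_count_def ecount_def)
  \<comment> \<open>One more than the count \<open>1 + M\<close> that stability would allow;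
    \<open>w\<close> fits exactly \<open>m\<close> full periods into the side of length
    \<open>2 * r\<close>.\<close>
  define m where "m = M + 2"
  define w where "w = pi * real m / r"
  have w: "0 < w" "w * (2 * r) = 2 * pi * real m" using r by (auto simp: w_def m_def)
  \<comment> \<open>The three terms ensure, in order, the curvature bound, a displacement below
    \<open>1 / k\<close>, and that the wave stays above the lower side of the square.\<close>
  define A where "A = min (k / w\<^sup>2) (min (1 / (2 * k)) r)"
  have A: "0 < A" "A \<le> k / w\<^sup>2" "A \<le> 1 / (2 * k)" "A \<le> r" using k r w by (auto simp: A_def)
  let ?\<gamma>' = "\<lambda>t. (t, A * sin (w * t))"
  have "\<bar>A\<bar> * w\<^sup>2 \<le> k" using A w by (simp add: field_simps)
  then have "trajectory k T ?\<gamma>'" by (rule trajectory_sine)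
  moreover have "dist (?\<gamma>' t) (\<gamma> t) \<le> A" for t
  proof -
    have "\<bar>A * sin (w * t)\<bar> \<le> A * 1" using A(1) unfolding abs_mult by (intro mult_mono) auto
    then show ?thesis by (simp add: \<gamma>_def dist_prod_def dist_real_def)
  qed
  moreover have "A < 1 / k" using A(3) k by (simp add: field_simps)
  ultimately have "small_perturbation k T \<gamma> ?\<gamma>'" unfolding small_perturbation_def by blast
  from M[OF this, of "(r, - r)"] one have "square_count r T ?\<gamma>' (r, - r) \<le> enat 1 + enat M"
    by (meson add_right_mono order_trans)
  moreover have "enat m \<le> square_count r T ?\<gamma>' (r, - r)"
  proof -
    let ?f = "\<lambda>j. ((2 * real j + 1) * pi / w, (2 * real j + 2) * pi / w)"
    have "?f ` {..<m} \<subseteq> maxints T ?\<gamma>' (square r (r, - r))"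
      unfolding T_def using sine_maxints[OF A(1) _ w] A r by auto
    moreover have "inj_on ?f {..<m}" using w(1) by (auto simp: inj_on_def)
    ultimately show ?thesis
      using ecount_ge_card[of "?f ` {..<m}"] unfolding square_count_def by (simp add: card_image)
  qed
  ultimately have "enat m \<le> enat (1 + M)" using order_trans by fastforce
  then show False by (simp add: m_def)
qed

theorem theorem2:
  fixes kmax :: real
  assumes "kmax > 0"
  shows "(\<forall>r>0. \<not> stable kmax (square_count r))
       \<and> (\<forall>r. 0 < r \<and> r < 1 / kmax \<longrightarrow> stable kmax (disk_count r))
       \<and> (\<forall>r1 r2. 0 < r1 \<and> r1 < r2 \<and> r2 < 1 / kmax \<longrightarrow> stable kmax (robust_count r1 r2))"
  using assms square_count_unstable stable_disk_count stable_robust_count by blast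

end
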